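(* Let $R = \mathcal{M}^0[I,G,\Lambda;P]$ be a normalized regular finite Rees $0$-matrix semigroup over a group $G$, where $I$ and $\Lambda$ are disjoint index sets and $P = (p_{\lambda,i})_{\lambda\in\Lambda,i\in I}$ is a $|\Lambda|\times|I|$ matrix over $G\cup\{0\}$, and let $S$ be a subsemigroup of $R$. Suppose that the number of connected components of the Graham-Houghton graph of $R$ is $n$, and let $G_1,\ldots,G_n\leq G$, $i_1,\ldots,i_n\in I$ and $\lambda_1,\ldots,\lambda_n\in\Lambda$ be the data of the normalization. Then $S$ is a maximal subsemigroup of $R$ that intersects every $\mathcal{H}$-class of $R$ non-trivially if and only if there exist a maximal subgroup $V$ of $G$ and elements $g_1=1_G, g_2,\ldots,g_n\in G$ such that $G_k\leq g_k^{-1}Vg_k$ for all $k\in\{1,\ldots,n\}$, and $$S=\langle E(R),\ \{i_1\}\times V\times\{\lambda_1\},\ x_2,\ldots,x_n,\ y_2,\ldots,y_n\rangle,$$ where $x_k=(i_1,g_k,\lambda_k)$ and $y_k=(i_k,g_k^{-1},\lambda_1)$ for all $k\in\{2,\ldots,n\}$.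
   Context: A subsemigroup is a subset closed under the operation; $\langle X\rangle$ denotes the least subsemigroup containing $X$ (sets listed inside $\langle\cdot\rangle$ contribute all their elements). A maximal subsemigroup is a proper subsemigroup not contained in any other proper subsemigroup. $E(R)$ is the set of idempotents of $R$. The Rees $0$-matrix semigroup $\mathcal{M}^0[I,G,\Lambda;P]$ (with $I,\Lambda$ non-empty disjoint sets, $G$ a group, $P=(p_{\lambda,i})$ a $|\Lambda|\times|I|$ matrix over $G\cup\{0\}$) is the set $(I\times G\times\Lambda)\cup\{0\}$ in which $0$ is a zero and $(i,g,\lambda)(j,h,\mu)=(i,gp_{\lambda,j}h,\mu)$ if $p_{\lambda,j}\neq0$ and $=0$ otherwise. A finite semigroup is regular if each of its $\mathcal{J}$-classes contains an idempotent (here: every row and every column of $P$ has a non-zero entry). The $\mathcal{H}$-classes of regular $R$ are $\{0\}$ and the sets $\{i\}\times G\times\{\lambda\}$; a subset intersects every $\mathcal{H}$-class non-trivially if it has non-empty intersection with each of them (including $\{0\}$). The Graham-Houghton graph of $R$ is the bipartite graph with vertex set $I\cup\Lambda$ and edges $\{i,\lambda\}$ whenever $p_{\lambda,i}\neq 0$. Let its connected components be $I_k\cup\Lambda_k$, $k=1,\ldots,n$, where $I_1,\ldots,I_n$ and $\Lambda_1,\ldots,\Lambda_n$ are non-empty sets partitioning $I$ and $\Lambda$. $R$ is normalized if there are $i_k\in I_k$, $\lambda_k\in\Lambda_k$ (which are fixed) with $p_{\lambda_k,i_k}=1_G$ for every $k$ such that, writing $\psi:R\setminus\{0\}\to G$,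 $(i,g,\lambda)\mapsto g$ (which restricts to an isomorphism $\{i\}\times G\times\{\lambda\}\to G$ whenever $p_{\lambda,i}=1_G$), for every $k$ the set $G_k=\big(\langle E(R)\rangle\cap(\{i_k\}\times G\times\{\lambda_k\})\big)\psi$ is a subgroup of $G$, and the submatrix $(p_{\lambda,i})_{\lambda\in\Lambda_k,i\in I_k}$ has all entries in $G_k\cup\{0\}$ and contains a generating set for $G_k$. *)

theory Defs
  imports "HOL-Algebra.Generated_Groups" "HOL.Hull"
begin

section \<open>Semigroups on a carrier set\<close>

text \<open>
  A semigroup is given by a carrier \<open>A\<close> and a binary operation \<open>f\<close>, of which only the
  restriction to \<open>A\<close> matters. The empty set counts as a subsemigroup.
\<close>

definition subsemigroup :: "'a set \<Rightarrow> ('a \<Rightarrow> 'a \<Rightarrow> 'a) \<Rightarrow> 'a set \<Rightarrow> bool" where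
  "subsemigroup A f T \<longleftrightarrow> T \<subseteq> A \<and> (\<forall>x\<in>T. \<forall>y\<in>T. f x y \<in> T)"

definition generated_subsemigroup :: "'a set \<Rightarrow> ('a \<Rightarrow> 'a \<Rightarrow> 'a) \<Rightarrow> 'a set \<Rightarrow> 'a set" where
  "generated_subsemigroup A f X = subsemigroup A f hull X"

definition maximal_subsemigroup :: "'a set \<Rightarrow> ('a \<Rightarrow> 'a \<Rightarrow> 'a) \<Rightarrow> 'a set \<Rightarrow> bool" where
  "maximal_subsemigroup A f M \<longleftrightarrow>
     subsemigroup A f M \<and> M \<noteq> A \<and>
     (\<forall>T. subsemigroup A f T \<and> T \<noteq> A \<and> M \<subseteq> T \<longrightarrow> T = M)"

definition idempotents :: "'a set \<Rightarrow> ('a \<Rightarrow> 'a \<Rightarrow> 'a) \<Rightarrow> 'a set" where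
  "idempotents A f = {e \<in> A. f e e = e}"

text \<open>Green's relations, defined by equality of the principal ideals generated by two elements;
  \<open>insert a\<close> accounts for the identity adjoined to the semigroup.\<close>

definition left_ideal :: "'a set \<Rightarrow> ('a \<Rightarrow> 'a \<Rightarrow> 'a) \<Rightarrow> 'a \<Rightarrow> 'a set" where
  "left_ideal A f a = insert a {f s a |s. s \<in> A}"

definition right_ideal :: "'a set \<Rightarrow> ('a \<Rightarrow> 'a \<Rightarrow> 'a) \<Rightarrow> 'a \<Rightarrow> 'a set" where
  "right_ideal A f a = insert a {f a s |s. s \<in> A}"

definition two_sided_ideal :: "'a set \<Rightarrow> ('a \<Rightarrow> 'a \<Rightarrow> 'a) \<Rightarrow> 'a \<Rightarrow> 'a set" where
  "two_sided_ideal A f a =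
     insert a ({f s a |s. s \<in> A} \<union> {f a t |t. t \<in> A} \<union> {f (f s a) t |s t. s \<in> A \<and> t \<in> A})"

definition green_H :: "'a set \<Rightarrow> ('a \<Rightarrow> 'a \<Rightarrow> 'a) \<Rightarrow> 'a rel" where
  "green_H A f = {(a, b) \<in> A \<times> A. left_ideal A f a = left_ideal A f b \<and>
                                   right_ideal A f a = right_ideal A f b}"

definition green_J :: "'a set \<Rightarrow> ('a \<Rightarrow> 'a \<Rightarrow> 'a) \<Rightarrow> 'a rel" where
  "green_J A f = {(a, b) \<in> A \<times> A. two_sided_ideal A f a = two_sided_ideal A f b}"

text \<open>For finite semigroups this agrees with von Neumann regularity.\<close>

definition regular_semigroup :: "'a set \<Rightarrow> ('a \<Rightarrow> 'a \<Rightarrow> 'a) \<Rightarrow> bool" where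
  "regular_semigroup A f \<longleftrightarrow> (\<forall>J \<in> A // green_J A f. J \<inter> idempotents A f \<noteq> {})"

definition maximal_subgroup :: "('g, 'm) monoid_scheme \<Rightarrow> 'g set \<Rightarrow> bool" where
  "maximal_subgroup G V \<longleftrightarrow>
     subgroup V G \<and> V \<noteq> carrier G \<and>
     (\<forall>H. subgroup H G \<and> H \<noteq> carrier G \<and> V \<subseteq> H \<longrightarrow> H = V)"


section \<open>Rees 0-matrix semigroups\<close>

text \<open>The selector \<open>psi\<close> is the map from the non-zero elements to the group; \<open>psi Zero\<close> is
  unspecified.\<close>

datatype ('i, 'g, 'l) rees = Zero | Elem 'i (psi: 'g) 'l

definition triples :: "'i set \<Rightarrow> 'g set \<Rightarrow> 'l set \<Rightarrow> ('i, 'g, 'l) rees set" where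
  "triples X Y Z = {Elem i g l |i g l. i \<in> X \<and> g \<in> Y \<and> l \<in> Z}"

text \<open>In matrix entries, \<open>None\<close> is the adjoined zero and \<open>Some g\<close> the group element \<open>g\<close>;
  the first argument of \<open>P\<close> is the row (an element of \<open>L\<close>), the second the column.\<close>

locale rees_zero_matrix = group G for G :: "('g, 'm) monoid_scheme" (structure) +
  fixes I L :: "'v set" and P :: "'v \<Rightarrow> 'v \<Rightarrow> 'g option"
  assumes I_nonempty: "I \<noteq> {}"
    and L_nonempty: "L \<noteq> {}"
    and disjoint: "I \<inter> L = {}"
    and entries: "\<And>l i. \<lbrakk>l \<in> L; i \<in> I\<rbrakk> \<Longrightarrow> P l i \<in> insert None (Some ` carrier G)"

definition rees_carrier ::
    "('g, 'm) monoid_scheme \<Rightarrow> 'i set \<Rightarrow> 'l set \<Rightarrow> ('i, 'g, 'l) rees set" where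
  "rees_carrier G I L = insert Zero (triples I (carrier G) L)"

fun rees_mult ::
    "('g, 'm) monoid_scheme \<Rightarrow> ('l \<Rightarrow> 'i \<Rightarrow> 'g option) \<Rightarrow>
     ('i, 'g, 'l) rees \<Rightarrow> ('i, 'g, 'l) rees \<Rightarrow> ('i, 'g, 'l) rees" where
  "rees_mult G P (Elem i g l) (Elem j h m) =
     (case P l j of None \<Rightarrow> Zero | Some p \<Rightarrow> Elem i (g \<otimes>\<^bsub>G\<^esub> p \<otimes>\<^bsub>G\<^esub> h) m)"
| "rees_mult G P Zero y = Zero"
| "rees_mult G P x Zero = Zero"


section \<open>The Graham-Houghton graph and normalization\<close>

definition gh_edges :: "'v set \<Rightarrow> 'v set \<Rightarrow> ('v \<Rightarrow> 'v \<Rightarrow> 'g option) \<Rightarrow> 'v set set" where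
  "gh_edges I L P = {{i, l} |i l. i \<in> I \<and> l \<in> L \<and> P l i \<noteq> None}"

definition gh_components :: "'v set \<Rightarrow> 'v set \<Rightarrow> ('v \<Rightarrow> 'v \<Rightarrow> 'g option) \<Rightarrow> 'v set set" where
  "gh_components I L P =
     (I \<union> L) // {(u, v). u \<in> I \<union> L \<and> v \<in> I \<union> L \<and> (u, v) \<in> {(a, b). {a, b} \<in> gh_edges I L P}\<^sup>*}"

text \<open>For \<open>i\<close> and \<open>l\<close> with entry \<open>P l i = \<one>\<close>, the image in the group of the part of the
  idempotent-generated subsemigroup lying in the \<open>\<H>\<close>-class of the position \<open>(i, l)\<close>.\<close>

definition idempotent_group ::
    "('g, 'm) monoid_scheme \<Rightarrow> 'i set \<Rightarrow> 'l set \<Rightarrow> ('l \<Rightarrow> 'i \<Rightarrow> 'g option) \<Rightarrow> 'i \<Rightarrow> 'l \<Rightarrow> 'g set" where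
  "idempotent_group G I L P i l =
     psi ` (generated_subsemigroup (rees_carrier G I L) (rees_mult G P)
              (idempotents (rees_carrier G I L) (rees_mult G P))
            \<inter> triples {i} (carrier G) {l})"

text \<open>The data of a normalization: \<open>C 1, \<dots>, C n\<close> enumerate the connected components without
  repetition, so that \<open>I \<inter> C k\<close> and \<open>L \<inter> C k\<close> are the two parts of the \<open>k\<close>-th component;
  \<open>ik k\<close> and \<open>lk k\<close> are the chosen indices and \<open>Gk k\<close> the resulting subgroups.\<close>

definition normalization ::
    "('g, 'm) monoid_scheme \<Rightarrow> 'v set \<Rightarrow> 'v set \<Rightarrow> ('v \<Rightarrow> 'v \<Rightarrow> 'g option) \<Rightarrow>
     nat \<Rightarrow> (nat \<Rightarrow> 'v set) \<Rightarrow> (nat \<Rightarrow> 'v) \<Rightarrow> (nat \<Rightarrow> 'v) \<Rightarrow> (nat \<Rightarrow> 'g set) \<Rightarrow> bool" where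
  "normalization G I L P n C ik lk Gk \<longleftrightarrow>
     bij_betw C {1..n} (gh_components I L P) \<and>
     (\<forall>k\<in>{1..n}.
        ik k \<in> I \<inter> C k \<and> lk k \<in> L \<inter> C k \<and> P (lk k) (ik k) = Some \<one>\<^bsub>G\<^esub> \<and>
        Gk k = idempotent_group G I L P (ik k) (lk k) \<and>
        subgroup (Gk k) G \<and>
        (\<forall>l \<in> L \<inter> C k. \<forall>i \<in> I \<inter> C k. P l i \<in> insert None (Some ` Gk k)) \<and>
        (\<exists>X. X \<subseteq> {p. \<exists>l \<in> L \<inter> C k. \<exists>i \<in> I \<inter> C k. P l i = Some p} \<and> generate G X = Gk k))"

end

theory Submission
  imports Defs "HOL-Algebra.Multiplicative_Group"
begin

text \<open>
  Fix elements \<open>x\<^sub>k = (i\<^sub>1, g\<^sub>k, \<lambda>\<^sub>k)\<close> and \<open>y\<^sub>k = (i\<^sub>k, g\<^sub>k\<^sup>-\<^sup>1, \<lambda>\<^sub>1)\<close>. For \<open>i \<in> I\<^sub>j\<close> and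
  \<open>\<lambda> \<in> \<Lambda>\<^sub>k\<close>, multiplying \<open>(i, h, \<lambda>)\<close> by idempotents and by \<open>x\<^sub>j\<close> and \<open>y\<^sub>k\<close> moves it to
  \<open>(i\<^sub>1, g\<^sub>j h g\<^sub>k\<^sup>-\<^sup>1, \<lambda>\<^sub>1)\<close>, and this can be undone. Hence a subsemigroup \<open>T\<close> that contains the
  idempotents, all \<open>x\<^sub>k\<close> and all \<open>y\<^sub>k\<close> is determined by the subgroup
  \<open>V = {v. (i\<^sub>1, v, \<lambda>\<^sub>1) \<in> T}\<close>: it consists of zero and of the blocks
  \<open>I\<^sub>j \<times> g\<^sub>j\<^sup>-\<^sup>1 V g\<^sub>k \<times> \<Lambda>\<^sub>k\<close>, where \<open>G\<^sub>k \<subseteq> g\<^sub>k\<^sup>-\<^sup>1 V g\<^sub>k\<close> is what makes this set closed.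
  By finiteness, a subsemigroup meeting every \<open>\<H>\<close>-class is of this form for some \<open>g\<close>, and
  maximality of \<open>T\<close> translates into maximality of \<open>V\<close>.
\<close>

section \<open>Generated subsemigroups, and subgroups of finite groups\<close>

lemma generated_subsemigroup_least:
  assumes "subsemigroup A f T" and "X \<subseteq> T"
  shows "generated_subsemigroup A f X \<subseteq> T"
  unfolding generated_subsemigroup_def using assms by (simp add: hull_minimal)

lemma generated_subsemigroup_superset: "X \<subseteq> generated_subsemigroup A f X"
  unfolding generated_subsemigroup_def by (rule hull_subset)

text \<open>Having \<open>A\<close> itself as a subsemigroup makes the intersected family non-empty,
  so the hull stays inside \<open>A\<close>.\<close>

lemma generated_subsemigroup_subsemigroup:
  assumes "subsemigroup A f A" and "X \<subseteq> A"
  shows "subsemigroup A f (generated_subsemigroup A f X)"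
proof -
  have "subsemigroup A f (\<Inter>{T. subsemigroup A f T \<and> X \<subseteq> T})"
    using assms unfolding subsemigroup_def by blast
  then show ?thesis by (simp add: generated_subsemigroup_def hull_def)
qed

lemma subsemigroup_mult:
  "subsemigroup A f T \<Longrightarrow> x \<in> T \<Longrightarrow> y \<in> T \<Longrightarrow> f x y \<in> T"
  by (simp add: subsemigroup_def)

lemma (in group) finite_closed_subgroup:
  assumes fin: "finite (carrier G)" and sub: "H \<subseteq> carrier G" and ne: "H \<noteq> {}"
    and closed: "\<And>x y. x \<in> H \<Longrightarrow> y \<in> H \<Longrightarrow> x \<otimes> y \<in> H"
  shows "subgroup H G"
proof (rule subgroupI[OF sub ne _ closed])
  fix a assume a: "a \<in> H"
  then have ac: "a \<in> carrier G" using sub by blast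
  have pow: "a [^] Suc m \<in> H" for m
    by (induction m) (use a ac closed in auto)
  have ord: "0 < order G" using fin by (simp add: order_gt_0_iff_finite)
  \<comment> \<open>The inverse of a is the power with exponent \<open>Suc m\<close> = 2|G| - 1.
    Twice the order is taken so that the exponent stays positive in the trivial group, where |G| - 1
    is 0.\<close>
  define m where "m = 2 * order G - 2"
  have "Suc (Suc m) = order G + order G" using ord by (simp add: m_def)
  then have "a [^] Suc m \<otimes> a = a [^] (order G + order G)" by (metis nat_pow_Suc)
  also have "\<dots> = \<one>"
    using ac by (simp add: pow_order_eq_1 flip: nat_pow_mult)
  finally have "inv a = a [^] Suc m" using ac inv_equality by simp
  then show "inv a \<in> H" using pow[of m] by simp
qed

section \<open>The normalized Rees 0-matrix semigroup\<close>

locale normalized_rees_zero_matrix = rees_zero_matrix G I L P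
  for G :: "('g, 'm) monoid_scheme" (structure) and I L :: "'v set"
    and P :: "'v \<Rightarrow> 'v \<Rightarrow> 'g option" +
  fixes n :: nat and C :: "nat \<Rightarrow> 'v set" and ik lk :: "nat \<Rightarrow> 'v" and Gk :: "nat \<Rightarrow> 'g set"
  assumes finite_rees: "finite (rees_carrier G I L)"
    and normalized: "normalization G I L P n C ik lk Gk"
begin

abbreviation R where "R \<equiv> rees_carrier G I L"

abbreviation rmult (infixl "\<bullet>" 70) where "x \<bullet> y \<equiv> rees_mult G P x y"

abbreviation E where "E \<equiv> idempotents R (rees_mult G P)"

abbreviation semi where "semi \<equiv> subsemigroup R (rees_mult G P)"

lemma Zero_in_R [simp]: "Zero \<in> R"
  by (simp add: rees_carrier_def)

lemma Elem_in_R [simp]: "Elem i h l \<in> R \<longleftrightarrow> i \<in> I \<and> h \<in> carrier G \<and> l \<in> L"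
  by (simp add: rees_carrier_def triples_def)

lemma mult_Zero_right [simp]: "x \<bullet> Zero = Zero"
  by (cases x) simp_all

lemma mult_Some [simp]: "P l j = Some p \<Longrightarrow> Elem i g l \<bullet> Elem j h m = Elem i (g \<otimes> p \<otimes> h) m"
  by simp

lemma entry_closed: "P l i = Some p \<Longrightarrow> l \<in> L \<Longrightarrow> i \<in> I \<Longrightarrow> p \<in> carrier G"
  using entries[of l i] by auto

lemma semi_R: "semi R"
proof -
  have "x \<bullet> y \<in> R" if "x \<in> R" "y \<in> R" for x y
    using that by (cases x; cases y) (auto split: option.split dest: entry_closed)
  then show ?thesis by (simp add: subsemigroup_def)
qed

lemma finite_carrier: "finite (carrier G)"
proof -
  obtain i l where "i \<in> I" "l \<in> L" using I_nonempty L_nonempty by blast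
  then have "(\<lambda>h. Elem i h l) ` carrier G \<subseteq> R" by auto
  then have "finite ((\<lambda>h. Elem i h l) ` carrier G)" using finite_rees finite_subset by blast
  then show ?thesis by (rule finite_imageD) (simp add: inj_on_def)
qed

section \<open>Connected components of the Graham-Houghton graph\<close>

abbreviation edge where "edge \<equiv> {(a, b). {a, b} \<in> gh_edges I L P}"

lemma edge_iff:
  "(a, b) \<in> edge \<longleftrightarrow> (a \<in> I \<and> b \<in> L \<and> P b a \<noteq> None) \<or> (b \<in> I \<and> a \<in> L \<and> P a b \<noteq> None)"
  by (auto simp: gh_edges_def doubleton_eq_iff)

abbreviation linked where
  "linked \<equiv> {(u, v). u \<in> I \<union> L \<and> v \<in> I \<union> L \<and> (u, v) \<in> edge\<^sup>*}"

lemma equiv_linked: "equiv (I \<union> L) linked"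
proof (rule equivI)
  have "sym edge" by (auto simp: sym_def insert_commute)
  then have "sym (edge\<^sup>*)" by (rule sym_rtrancl)
  then show "sym linked" by (auto simp: sym_def)
qed (auto simp: refl_on_def trans_def)

lemma C_component: "k \<in> {1..n} \<Longrightarrow> C k \<in> (I \<union> L) // linked"
  and C_bij: "bij_betw C {1..n} ((I \<union> L) // linked)"
  using normalized unfolding normalization_def gh_components_def by (auto simp: bij_betw_def)

lemma C_linked: "k \<in> {1..n} \<Longrightarrow> u \<in> C k \<Longrightarrow> v \<in> C k \<Longrightarrow> (u, v) \<in> edge\<^sup>*"
  using quotient_eq_iff[OF equiv_linked C_component C_component, of k k u v] by auto

lemma C_edge:
  assumes "k \<in> {1..n}" "u \<in> C k" "(u, v) \<in> edge" shows "v \<in> C k"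
proof -
  have "u \<in> I \<union> L" "v \<in> I \<union> L" using assms(3) unfolding edge_iff by auto
  then have "(u, v) \<in> linked" using assms(3) by auto
  then show ?thesis using in_quotient_imp_closed[OF equiv_linked C_component] assms by blast
qed

lemma C_unique: "j \<in> {1..n} \<Longrightarrow> k \<in> {1..n} \<Longrightarrow> v \<in> C j \<Longrightarrow> v \<in> C k \<Longrightarrow> j = k"
  using quotient_disj[OF equiv_linked C_component C_component, of j k]
    C_bij unfolding bij_betw_def inj_on_def by blast

lemma C_cover: assumes "v \<in> I \<union> L" shows "\<exists>k\<in>{1..n}. v \<in> C k"
proof -
  have "v \<in> \<Union>((I \<union> L) // linked)" using Union_quotient[OF equiv_linked] assms by simp
  then show ?thesis using C_bij unfolding bij_betw_def by auto
qed

definition comp where "comp v = (THE k. k \<in> {1..n} \<and> v \<in> C k)"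

lemma comp_eq: "k \<in> {1..n} \<Longrightarrow> v \<in> C k \<Longrightarrow> comp v = k"
  unfolding comp_def using C_unique by blast

lemma comp_in: "v \<in> I \<union> L \<Longrightarrow> comp v \<in> {1..n}"
  and in_C_comp: "v \<in> I \<union> L \<Longrightarrow> v \<in> C (comp v)"
  using C_cover comp_eq by metis+

lemma one_in: "1 \<in> {1..n}"
proof -
  obtain i where "i \<in> I" using I_nonempty by blast
  then show ?thesis using comp_in[of i] by simp
qed

section \<open>Consequences of the normalization\<close>

lemma normalized_at:
  assumes "k \<in> {1..n}"
  shows "ik k \<in> I \<inter> C k" and "lk k \<in> L \<inter> C k" and P_lk_ik: "P (lk k) (ik k) = Some \<one>"
    and Gk_eq: "Gk k = idempotent_group G I L P (ik k) (lk k)"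
    and Gk_subgroup: "subgroup (Gk k) G"
    and "\<And>l i. l \<in> L \<inter> C k \<Longrightarrow> i \<in> I \<inter> C k \<Longrightarrow> P l i \<in> insert None (Some ` Gk k)"
proof -
  note N = bspec[OF conjunct2[OF normalized[unfolded normalization_def]] assms]
  from N show "ik k \<in> I \<inter> C k" by (elim conjE)
  from N show "lk k \<in> L \<inter> C k" by (elim conjE)
  from N show "P (lk k) (ik k) = Some \<one>" by (elim conjE)
  from N show "Gk k = idempotent_group G I L P (ik k) (lk k)" by (elim conjE)
  from N show "subgroup (Gk k) G" by (elim conjE)
  from N have "\<forall>l \<in> L \<inter> C k. \<forall>i \<in> I \<inter> C k. P l i \<in> insert None (Some ` Gk k)"
    by (elim conjE)
  then show "\<And>l i. l \<in> L \<inter> C k \<Longrightarrow> i \<in> I \<inter> C k \<Longrightarrow> P l i \<in> insert None (Some ` Gk k)"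
    by blast
qed

lemma
  assumes k: "k \<in> {1..n}"
  shows ik_in: "ik k \<in> I" and lk_in: "lk k \<in> L"
    and comp_ik: "comp (ik k) = k" and comp_lk: "comp (lk k) = k"
proof -
  have "ik k \<in> C k" "lk k \<in> C k" using normalized_at(1,2)[OF k] by auto
  then show "comp (ik k) = k" "comp (lk k) = k" by (auto intro: comp_eq[OF k])
  show "ik k \<in> I" "lk k \<in> L" using normalized_at(1,2)[OF k] by auto
qed

lemma Gk_carrier: "k \<in> {1..n} \<Longrightarrow> a \<in> Gk k \<Longrightarrow> a \<in> carrier G"
  using subgroup.mem_carrier[OF Gk_subgroup] .

text \<open>A non-zero entry is an edge, so the matrix is block diagonal with respect to the
  components.\<close>

lemma comp_entry:
  assumes "P l i = Some p" "l \<in> L" "i \<in> I" shows "comp l = comp i"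
proof -
  have i: "comp i \<in> {1..n}" "i \<in> C (comp i)" using comp_in in_C_comp assms by auto
  have "(i, l) \<in> edge" unfolding edge_iff using assms by simp
  then show ?thesis using comp_eq[OF i(1)] C_edge[OF i] by blast
qed

lemma entry_in_Gk:
  assumes "P l i = Some p" "l \<in> L" "i \<in> I" shows "p \<in> Gk (comp i)"
proof -
  have "i \<in> I \<inter> C (comp i)" "l \<in> L \<inter> C (comp i)"
    using assms in_C_comp[of i] in_C_comp[of l] comp_entry[OF assms] by auto
  then have "P l i \<in> insert None (Some ` Gk (comp i))"
    using normalized_at(6)[of "comp i" l i] comp_in[of i] assms by simp
  then show ?thesis using assms by auto
qed

lemma
  assumes v: "v \<in> I \<union> L"
  shows linked_lk: "(v, lk (comp v)) \<in> edge\<^sup>*" and linked_ik: "(ik (comp v), v) \<in> edge\<^sup>*"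
  using C_linked[OF comp_in[OF v]] in_C_comp[OF v] normalized_at(1,2)[OF comp_in[OF v]] by auto

text \<open>The vertex \<open>lk (comp i)\<close> lies in the component of \<open>i\<close> but on
  the other side of the graph, so a path to it must leave \<open>i\<close> along an edge.\<close>

lemma column_nonzero:
  assumes "i \<in> I" obtains l p where "l \<in> L" "P l i = Some p"
proof -
  have "i \<noteq> lk (comp i)" using assms lk_in[OF comp_in, of i] disjoint by auto
  moreover have "(i, lk (comp i)) \<in> edge\<^sup>*" using linked_lk assms by simp
  ultimately obtain v where "(i, v) \<in> edge" by (meson converse_rtranclE)
  then show ?thesis using assms that disjoint unfolding edge_iff by blast
qed

text \<open>Dual argument, with the last edge of a path from \<open>ik (comp l)\<close>.\<close>

lemma row_nonzero:
  assumes "l \<in> L" obtains i p where "i \<in> I" "P l i = Some p"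
proof -
  have "l \<noteq> ik (comp l)" using assms ik_in[OF comp_in, of l] disjoint by auto
  moreover have "(ik (comp l), l) \<in> edge\<^sup>*" using linked_ik assms by simp
  ultimately obtain v where "(v, l) \<in> edge" by (metis rtranclE)
  then show ?thesis using assms that disjoint unfolding edge_iff by blast
qed

section \<open>Idempotents and the subsemigroup they generate\<close>

lemma mem_E_iff:
  "x \<in> E \<longleftrightarrow> x = Zero \<or> (\<exists>i l p. i \<in> I \<and> l \<in> L \<and> P l i = Some p \<and> x = Elem i (inv p) l)"
proof (cases x)
  case Zero
  then show ?thesis by (simp add: idempotents_def)
next
  case (Elem i h l)
  \<comment> \<open>Where the entry is p, being idempotent means h p h = h, solved by cancelling h.
    Where the entry is zero, the square is \<open>Zero\<close> and there is no idempotent.\<close>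
  have "h \<otimes> p \<otimes> h = h \<longleftrightarrow> h = inv p" if "h \<in> carrier G" "p \<in> carrier G" for p
  proof -
    have "h \<otimes> p \<otimes> h = h \<longleftrightarrow> h \<otimes> p = \<one>" using that by simp
    also have "\<dots> \<longleftrightarrow> h = inv p" using that inv_equality l_inv by blast
    finally show ?thesis .
  qed
  then have "Elem i h l \<in> R \<and> Elem i h l \<bullet> Elem i h l = Elem i h l \<longleftrightarrow>
      (\<exists>p. i \<in> I \<and> l \<in> L \<and> P l i = Some p \<and> h = inv p)"
    using entry_closed by (cases "P l i") (simp, force)
  then show ?thesis using Elem by (auto simp: idempotents_def)
qed

abbreviation IG where "IG \<equiv> generated_subsemigroup R (rees_mult G P) E"

lemma semi_IG: "semi IG"
  by (rule generated_subsemigroup_subsemigroup[OF semi_R]) (auto simp: idempotents_def)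

lemma idempotent_in_IG:
  "i \<in> I \<Longrightarrow> l \<in> L \<Longrightarrow> P l i = Some p \<Longrightarrow> Elem i (inv p) l \<in> IG"
  by (rule subsetD[OF generated_subsemigroup_superset], unfold mem_E_iff) blast

text \<open>Multiplying the idempotents at the edges of a path from \<open>i\<close> to \<open>v\<close> gives a non-zero element,
  because consecutive idempotents meet in a non-zero entry.\<close>

lemma path_product:
  assumes i: "i \<in> I" and path: "(i, v) \<in> edge\<^sup>*"
  shows "(v \<in> L \<longrightarrow> (\<exists>h \<in> Gk (comp i). Elem i h v \<in> IG)) \<and>
    (v \<in> I \<longrightarrow> v = i \<or> (\<exists>l\<in>L. \<exists>h \<in> Gk (comp i). Elem i h l \<in> IG \<and> P l v \<noteq> None)) \<and>
    comp v = comp i"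
  using path
proof (induction rule: rtrancl_induct)
  case base
  then show ?case using i disjoint by blast
next
  case (step v w)
  interpret K: subgroup "Gk (comp i)" G using Gk_subgroup comp_in i by simp
  from step.hyps(2) consider (IL) "v \<in> I" "w \<in> L" "P w v \<noteq> None" | (LI) "w \<in> I" "v \<in> L" "P v w \<noteq> None"
    unfolding edge_iff by blast
  then show ?case
  proof cases
    case IL
    then obtain p where p: "P w v = Some p" by blast
    then have pK: "p \<in> Gk (comp i)" using entry_in_Gk[of w v p] IL step.IH by simp
    have e: "Elem v (inv p) w \<in> IG" using idempotent_in_IG IL p by blast
    have "\<exists>h \<in> Gk (comp i). Elem i h w \<in> IG"
    proof (cases "v = i")
      case True
      then show ?thesis using e pK by blast
    next
      case False
      then obtain l h q where l: "l \<in> L" "h \<in> Gk (comp i)" "Elem i h l \<in> IG" "P l v = Some q"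
        using step.IH IL by blast
      have "q \<in> Gk (comp i)" using entry_in_Gk[of l v q] IL l step.IH by simp
      \<comment> \<open>The path is extended by the idempotent of its last edge: (i, h, l) times (v,
        p^-1, w) is (i, h q p^-1, w).\<close>
      then show ?thesis using subsemigroup_mult[OF semi_IG l(3) e] l pK
        by (intro bexI[of _ "h \<otimes> q \<otimes> inv p"]) simp_all
    qed
    then show ?thesis using IL disjoint comp_entry[OF p] step.IH by auto
  next
    \<comment> \<open>A step from \<open>L\<close> to \<open>I\<close> multiplies nothing: the
      element ending in \<open>v\<close> is kept, and the edge just traversed is the non-zero entry
      that the next idempotent will use.\<close>
    case LI
    then show ?thesis using disjoint step.IH comp_entry by fastforce
  qed
qed

text \<open>Path products supply elements (i, a, \<open>lk k\<close>) and (\<open>ik k\<close>, b,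
  l) with a and b in \<open>Gk k\<close>. Between them any element of \<open>Gk k\<close> can be
  inserted in the position (\<open>ik k\<close>, \<open>lk k\<close>), where the entry is the
  identity.\<close>

lemma block_in_IG:
  assumes i: "i \<in> I" and l: "l \<in> L" and eq: "comp i = comp l" and h: "h \<in> Gk (comp i)"
  shows "Elem i h l \<in> IG"
proof -
  define k where "k = comp i"
  have k: "k \<in> {1..n}" using i comp_in k_def by simp
  interpret K: subgroup "Gk k" G using Gk_subgroup k by simp
  have sq: "Elem (ik k) a (lk k) \<in> IG" if "a \<in> Gk k" for a
  proof -
    have "a \<in> psi ` (IG \<inter> triples {ik k} (carrier G) {lk k})"
      using that unfolding Gk_eq[OF k] idempotent_group_def .
    then obtain z where "a = psi z" "z \<in> IG" "z \<in> triples {ik k} (carrier G) {lk k}" by blast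
    moreover from this(1,3) have "z = Elem (ik k) a (lk k)" unfolding triples_def by force
    ultimately show ?thesis by simp
  qed
  obtain a where a: "a \<in> Gk k" "Elem i a (lk k) \<in> IG"
    using path_product[OF i linked_lk] i lk_in k k_def by auto
  obtain b where b: "b \<in> Gk k" "Elem (ik k) b l \<in> IG"
    using path_product[OF ik_in[OF k], of l] linked_ik[of l] l eq comp_ik[OF k] k_def[symmetric]
    by auto
  \<comment> \<open>The middle factor is the solution x of a x b = h; it lies in \<open>Gk k\<close>
    because a, b and h do.\<close>
  have "Elem i a (lk k) \<bullet> Elem (ik k) (inv a \<otimes> h \<otimes> inv b) (lk k) \<bullet> Elem (ik k) b l \<in> IG"
    using a b h[folded k_def] sq by (intro subsemigroup_mult[OF semi_IG]) auto
  moreover have "a \<otimes> (inv a \<otimes> h \<otimes> inv b) \<otimes> b = h"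
    using a b h[folded k_def]
    by (simp add: K.mem_carrier m_assoc flip: m_assoc[of a "inv a"])
  ultimately show ?thesis using a b h[folded k_def] by (simp add: P_lk_ik[OF k] K.mem_carrier)
qed

lemma IG_least: "semi T \<Longrightarrow> E \<subseteq> T \<Longrightarrow> IG \<subseteq> T"
  by (rule generated_subsemigroup_least)

section \<open>Blocks determined by a subgroup and conjugating elements\<close>

text \<open>The union of zero and the sets \<open>I\<^sub>j \<times> g\<^sub>j\<^sup>-\<^sup>1 V g\<^sub>k \<times> \<Lambda>\<^sub>k\<close>.\<close>

definition block where
  "block V g = insert Zero {Elem i h l |i h l. i \<in> I \<and> h \<in> carrier G \<and> l \<in> L \<and>
     g (comp i) \<otimes> h \<otimes> inv (g (comp l)) \<in> V}"

lemma Zero_in_block [simp]: "Zero \<in> block V g"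
  by (simp add: block_def)

lemma Elem_in_block: "Elem i h l \<in> block V g \<longleftrightarrow>
    i \<in> I \<and> h \<in> carrier G \<and> l \<in> L \<and> g (comp i) \<otimes> h \<otimes> inv (g (comp l)) \<in> V"
  by (simp add: block_def)

text \<open>The inclusion of each \<open>Gk k\<close> in a conjugate of \<open>V\<close>, stated
  elementwise: this is the form in which sandwich entries appear when products in a block are
  computed.\<close>

definition conjugates_into where
  "conjugates_into V g \<longleftrightarrow> (\<forall>k\<in>{1..n}. \<forall>a\<in>Gk k. g k \<otimes> a \<otimes> inv (g k) \<in> V)"

context
  fixes g :: "nat \<Rightarrow> 'g"
  assumes g_closed: "\<And>k. k \<in> {1..n} \<Longrightarrow> g k \<in> carrier G"
begin

lemma g_comp_closed: "v \<in> I \<union> L \<Longrightarrow> g (comp v) \<in> carrier G"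
  using g_closed comp_in by blast

lemma conjugates_into_iff:
  assumes "subgroup V G"
  shows "conjugates_into V g \<longleftrightarrow> (\<forall>k\<in>{1..n}. Gk k \<subseteq> (inv (g k) <# V) #> g k)"
proof -
  have "a \<in> (inv (g k) <# V) #> g k \<longleftrightarrow> g k \<otimes> a \<otimes> inv (g k) \<in> V"
    if k: "k \<in> {1..n}" and a: "a \<in> Gk k" for k a
  proof
    assume "a \<in> (inv (g k) <# V) #> g k"
    then obtain v where v: "v \<in> V" "a = inv (g k) \<otimes> v \<otimes> g k"
      by (auto simp: l_coset_def r_coset_def)
    have "v \<in> carrier G" using v assms subgroup.mem_carrier by metis
    then have "g k \<otimes> a \<otimes> inv (g k) = v"
      using v g_closed[OF k] by (simp add: m_assoc flip: m_assoc[of "g k" "inv (g k)"])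
    then show "g k \<otimes> a \<otimes> inv (g k) \<in> V" using v by simp
  next
    assume "g k \<otimes> a \<otimes> inv (g k) \<in> V"
    moreover have "a = inv (g k) \<otimes> (g k \<otimes> a \<otimes> inv (g k)) \<otimes> g k"
      using g_closed[OF k] Gk_carrier[OF k a]
      by (simp add: m_assoc flip: m_assoc[of "inv (g k)" "g k"])
    ultimately show "a \<in> (inv (g k) <# V) #> g k"
      by (auto simp: l_coset_def r_coset_def)
  qed
  then show ?thesis unfolding conjugates_into_def by blast
qed

text \<open>Transporting both factors to the first component replaces the sandwich entry p by a
  conjugate of p. As p lies in the group of its component, this conjugate is in \<open>V\<close>,
  and the product becomes one of three elements of \<open>V\<close>.\<close>

lemma semi_block:
  assumes V: "subgroup V G" and conj: "conjugates_into V g"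
  shows "semi (block V g)"
proof -
  interpret V: subgroup V G by fact
  have "Elem i h l \<bullet> Elem j h' m \<in> block V g"
    if x: "Elem i h l \<in> block V g" and y: "Elem j h' m \<in> block V g" for i h l j h' m
  proof (cases "P l j")
    case None
    then show ?thesis by simp
  next
    case (Some p)
    let ?a = "g (comp i)" and ?b = "g (comp j)" and ?c = "g (comp m)"
    have mem: "i \<in> I" "l \<in> L" "j \<in> I" "m \<in> L" "h \<in> carrier G" "h' \<in> carrier G"
      using x y by (auto simp: Elem_in_block)
    have p: "p \<in> carrier G" "p \<in> Gk (comp j)" "comp l = comp j"
      using mem Some entry_closed entry_in_Gk comp_entry by auto
    have gc: "?a \<in> carrier G" "?b \<in> carrier G" "?c \<in> carrier G"
      using g_comp_closed mem by auto
    have "?b \<otimes> p \<otimes> inv ?b \<in> V"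
      using conj p mem comp_in unfolding conjugates_into_def by blast
    \<comment> \<open>Because \<open>comp l = comp j\<close>, the same element \<open>?b\<close>
      closes the first factor and opens the last, so the conjugators cancel.\<close>
    then have "(?a \<otimes> h \<otimes> inv ?b) \<otimes> (?b \<otimes> p \<otimes> inv ?b) \<otimes> (?b \<otimes> h' \<otimes> inv ?c) \<in> V"
      using x y p by (simp add: Elem_in_block)
    also have "(?a \<otimes> h \<otimes> inv ?b) \<otimes> (?b \<otimes> p \<otimes> inv ?b) \<otimes> (?b \<otimes> h' \<otimes> inv ?c)
        = ?a \<otimes> (h \<otimes> p \<otimes> h') \<otimes> inv ?c"
      using gc mem p by (simp add: m_assoc flip: m_assoc[of "inv ?b" ?b])
    finally show ?thesis using Some mem p by (simp add: Elem_in_block)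
  qed
  moreover have "block V g \<subseteq> R" by (auto simp: block_def)
  ultimately show ?thesis unfolding subsemigroup_def
    by (metis Zero_in_block mult_Zero_right rees.exhaust rees_mult.simps(2))
qed

text \<open>A non-zero idempotent carries the inverse of an entry, and its two indices share a
  component, so its transport is a conjugate of an element of the group of that component.\<close>

lemma E_subset_block:
  assumes V: "subgroup V G" and conj: "conjugates_into V g"
  shows "E \<subseteq> block V g"
proof
  fix x assume "x \<in> E"
  then consider "x = Zero"
    | i l p where "i \<in> I" "l \<in> L" "P l i = Some p" "x = Elem i (inv p) l"
    unfolding mem_E_iff by blast
  then show "x \<in> block V g"
  proof cases
    case 2
    have "inv p \<in> Gk (comp i)"
      using subgroup.m_inv_closed[OF Gk_subgroup] entry_in_Gk comp_in 2 by blast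
    then have "g (comp i) \<otimes> inv p \<otimes> inv (g (comp i)) \<in> V"
      using conj 2 comp_in unfolding conjugates_into_def by blast
    then show ?thesis
      using 2 comp_entry[of l i p] entry_closed[of l i p] by (simp add: Elem_in_block)
  qed simp
qed

text \<open>Sandwiching between \<open>x\<^sub>j\<close> and \<open>y\<^sub>k\<close> transports every \<open>\<H>\<close>-class to the first one.\<close>

lemma subsemigroup_eq_block:
  assumes T: "semi T" and E: "E \<subseteq> T" and g1: "g 1 = \<one>"
    and x: "\<And>k. k \<in> {2..n} \<Longrightarrow> Elem (ik 1) (g k) (lk k) \<in> T"
    and y: "\<And>k. k \<in> {2..n} \<Longrightarrow> Elem (ik k) (inv (g k)) (lk 1) \<in> T"
  shows "T = block {v \<in> carrier G. Elem (ik 1) v (lk 1) \<in> T} g" (is "_ = block ?V g")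
proof -
  have IG: "z \<in> T" if "z \<in> IG" for z using that IG_least[OF T E] by blast
  \<comment> \<open>This is x_1 = y_1. Only the pairs with k at least 2 are assumed to lie in
    \<open>T\<close>; the missing one comes from the idempotents.\<close>
  have one: "Elem (ik 1) \<one> (lk 1) \<in> T"
    using IG block_in_IG[OF ik_in lk_in, of 1 1 \<one>] one_in comp_ik comp_lk
      subgroup.one_closed[OF Gk_subgroup] by metis
  have x': "Elem (ik 1) (g k) (lk k) \<in> T" and y': "Elem (ik k) (inv (g k)) (lk 1) \<in> T"
    if "k \<in> {1..n}" for k
  proof -
    have "k = 1 \<or> k \<in> {2..n}" using that by auto
    then consider "k = 1" | "k \<in> {2..n}" by blast
    then show "Elem (ik 1) (g k) (lk k) \<in> T" "Elem (ik k) (inv (g k)) (lk 1) \<in> T"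
      using x y one g1 by (cases; simp)+
  qed
  have iff: "Elem i h l \<in> T \<longleftrightarrow> Elem i h l \<in> block ?V g"
    if il: "i \<in> I" "l \<in> L" and h: "h \<in> carrier G" for i h l
  proof -
    define j k where "j = comp i" and "k = comp l"
    have jk: "j \<in> {1..n}" "k \<in> {1..n}" using il comp_in j_def k_def by auto
    have gjk: "g j \<in> carrier G" "g k \<in> carrier G" using g_closed jk by auto
    have in_block: "Elem i h l \<in> block ?V g \<longleftrightarrow> Elem (ik 1) (g j \<otimes> h \<otimes> inv (g k)) (lk 1) \<in> T"
      using il h gjk by (simp add: Elem_in_block j_def k_def)
    show ?thesis unfolding in_block
    proof
      assume t: "Elem i h l \<in> T"
      \<comment> \<open>The non-zero entries q in column \<open>i\<close> and r in row
        \<open>l\<close> give access to the element from both sides. The factors with coordinates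
        q^-1 and r^-1 cancel them, so the fivefold product has coordinate g_j h g_k^-1.\<close>
      obtain m q where q: "m \<in> L" "P m i = Some q" using column_nonzero il by blast
      obtain s r where r: "s \<in> I" "P l s = Some r" using row_nonzero il by blast
      have qr: "q \<in> Gk j" "r \<in> Gk k" "comp m = j" "comp s = k"
        using entry_in_Gk comp_entry q r il by (auto simp: j_def k_def comp_entry)
      then have qrc: "q \<in> carrier G" "r \<in> carrier G" using Gk_carrier jk by auto
      have "Elem (ik j) (inv q) m \<in> T" "Elem s (inv r) (lk k) \<in> T"
        using q r qr jk ik_in lk_in comp_ik comp_lk subgroup.m_inv_closed[OF Gk_subgroup]
        by (auto intro!: IG block_in_IG)
      then have "Elem (ik 1) (g j) (lk j) \<bullet> Elem (ik j) (inv q) m \<bullet> Elem i h l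
          \<bullet> Elem s (inv r) (lk k) \<bullet> Elem (ik k) (inv (g k)) (lk 1) \<in> T"
        using t x' y' jk by (intro subsemigroup_mult[OF T]) auto
      then show "Elem (ik 1) (g j \<otimes> h \<otimes> inv (g k)) (lk 1) \<in> T"
        using q r qrc gjk h jk P_lk_ik
        by (simp add: m_assoc flip: m_assoc[of "inv q" q] m_assoc[of r "inv r"])
    next
      assume t: "Elem (ik 1) (g j \<otimes> h \<otimes> inv (g k)) (lk 1) \<in> T"
      \<comment> \<open>For the way back, all four sandwich entries of the product are the identity,
        and y_j and x_k remove the outer g_j and g_k^-1.\<close>
      have "Elem i \<one> (lk j) \<in> T" "Elem (ik k) \<one> l \<in> T"
        using il jk ik_in lk_in comp_ik comp_lk subgroup.one_closed[OF Gk_subgroup] j_def k_def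
        by (auto intro!: IG block_in_IG)
      then have "Elem i \<one> (lk j) \<bullet> Elem (ik j) (inv (g j)) (lk 1)
          \<bullet> Elem (ik 1) (g j \<otimes> h \<otimes> inv (g k)) (lk 1)
          \<bullet> Elem (ik 1) (g k) (lk k) \<bullet> Elem (ik k) \<one> l \<in> T"
        using t x' y' jk by (intro subsemigroup_mult[OF T]) auto
      moreover have "inv (g j) \<otimes> (g j \<otimes> h \<otimes> inv (g k)) \<otimes> g k = h"
        using gjk h by (simp add: m_assoc flip: m_assoc[of "inv (g j)" "g j"])
      ultimately show "Elem i h l \<in> T"
        using gjk h jk one_in P_lk_ik by simp
    qed
  qed
  have Z: "Zero \<in> T" using E mem_E_iff by blast
  have TR: "T \<subseteq> R" using T by (simp add: subsemigroup_def)
  have "z \<in> T \<longleftrightarrow> z \<in> block ?V g" for z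
  proof (cases z)
    case (Elem i h l)
    have "i \<in> I \<and> h \<in> carrier G \<and> l \<in> L" if "z \<in> T \<or> z \<in> block ?V g"
      using that subsetD[OF TR, of z] unfolding Elem Elem_in_block Elem_in_R by blast
    then show ?thesis using iff[of i l h] unfolding Elem by blast
  qed (simp add: Z)
  then show ?thesis by blast
qed

text \<open>Since \<open>g 1\<close> is the identity, the part of a block in the position
  (\<open>ik 1\<close>, \<open>lk 1\<close>) is a copy of \<open>V\<close>, from which
  \<open>V\<close> can be read off.\<close>

lemma block_eq_R_iff:
  assumes V: "V \<subseteq> carrier G" and g1: "g 1 = \<one>"
  shows "block V g = R \<longleftrightarrow> V = carrier G"
proof
  assume eq: "block V g = R"
  have "v \<in> V" if "v \<in> carrier G" for v
  proof -
    have "Elem (ik 1) v (lk 1) \<in> block V g" unfolding eq using that one_in ik_in lk_in by simp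
    then show ?thesis using g1 that one_in comp_ik comp_lk by (simp add: Elem_in_block)
  qed
  then show "V = carrier G" using V by blast
next
  assume "V = carrier G"
  then show "block V g = R"
    using g_comp_closed by (auto simp: block_def rees_carrier_def triples_def)
qed

lemma block_inject:
  assumes "block V g = block W g" "V \<subseteq> carrier G" "W \<subseteq> carrier G" and g1: "g 1 = \<one>"
  shows "V = W"
proof -
  have "v \<in> U \<longleftrightarrow> Elem (ik 1) v (lk 1) \<in> block U g" if "v \<in> carrier G" for v U
    using g1 that one_in comp_ik comp_lk ik_in lk_in by (simp add: Elem_in_block)
  then have "v \<in> V \<longleftrightarrow> v \<in> W" if "v \<in> carrier G" for v using that assms(1) by simp
  then show ?thesis using assms(2,3) by blast
qed

lemma block_mono: "V \<subseteq> W \<Longrightarrow> block V g \<subseteq> block W g"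
  by (auto simp: block_def)

abbreviation gens where
  "gens V \<equiv> E \<union> triples {ik 1} V {lk 1}
     \<union> {Elem (ik 1) (g k) (lk k) |k. k \<in> {2..n}}
     \<union> {Elem (ik k) (inv (g k)) (lk 1) |k. k \<in> {2..n}}"

text \<open>The block is a subsemigroup containing the generators. Conversely, the generated
  subsemigroup is itself a block for the same \<open>g\<close>, over a set \<open>?W\<close> that
  contains \<open>V\<close>.\<close>

lemma generated_eq_block:
  assumes V: "subgroup V G" and conj: "conjugates_into V g" and g1: "g 1 = \<one>"
  shows "generated_subsemigroup R (rees_mult G P) (gens V) = block V g" (is "?T = _")
proof -
  interpret V: subgroup V G by fact
  \<comment> \<open>Both x_k and y_k are transported to the identity, because \<open>g 1\<close> is
    the identity.\<close>
  have gens_block: "gens V \<subseteq> block V g"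
    using E_subset_block[OF V conj] g_closed g1 one_in ik_in lk_in comp_ik comp_lk
    by (auto simp: Elem_in_block triples_def)
  have "gens V \<subseteq> R" using gens_block semi_block[OF V conj] by (auto simp: subsemigroup_def)
  then have T: "semi ?T" by (rule generated_subsemigroup_subsemigroup[OF semi_R])
  have gens_T: "gens V \<subseteq> ?T" by (rule generated_subsemigroup_superset)
  let ?W = "{v \<in> carrier G. Elem (ik 1) v (lk 1) \<in> ?T}"
  have "?T = block ?W g"
    by (rule subsemigroup_eq_block[OF T _ g1]) (use gens_T in auto)
  moreover have "V \<subseteq> ?W"
    using gens_T V.mem_carrier by (auto simp: triples_def)
  ultimately have "block V g \<subseteq> ?T" using block_mono by blast
  moreover have "?T \<subseteq> block V g"
    by (rule generated_subsemigroup_least[OF semi_block[OF V conj] gens_block])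
  ultimately show ?thesis by blast
qed

end

section \<open>Green's H-classes\<close>

lemma green_H_Zero: "green_H R (rees_mult G P) `` {Zero} = {Zero}"
proof -
  have "left_ideal R (rees_mult G P) Zero = {Zero}" by (auto simp: left_ideal_def)
  then have "(Zero, x) \<in> green_H R (rees_mult G P) \<longleftrightarrow> x = Zero" for x
    by (force simp: green_H_def left_ideal_def)
  then show ?thesis by blast
qed

text \<open>Through a non-zero entry p of column \<open>i\<close>, a left factor with coordinate h
  g^-1 p^-1 replaces g by any h.\<close>

lemma left_ideal_Elem:
  assumes "Elem i g l \<in> R"
  shows "left_ideal R (rees_mult G P) (Elem i g l) = insert Zero (triples I (carrier G) {l})"
    (is "?A = ?B")
proof
  show "?A \<subseteq> ?B"
    using assms unfolding left_ideal_def
    by (auto simp: triples_def rees_carrier_def split: option.splits intro!: m_closed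
        dest: entry_closed)
  have "Zero \<in> ?A" unfolding left_ideal_def by (auto intro!: exI[of _ Zero])
  moreover have "Elem j h l \<in> ?A" if "j \<in> I" "h \<in> carrier G" for j h
  proof -
    obtain m p where m: "m \<in> L" "P m i = Some p" using column_nonzero assms by auto
    have p: "p \<in> carrier G" using m entry_closed assms by simp
    have eq: "Elem j h l = Elem j (h \<otimes> inv g \<otimes> inv p) m \<bullet> Elem i g l"
      using m p that assms by (simp add: m_assoc flip: m_assoc[of "inv p" p])
    have "Elem j (h \<otimes> inv g \<otimes> inv p) m \<in> R" using m p that assms by simp
    with eq show ?thesis unfolding left_ideal_def by (intro insertI2 CollectI exI conjI)
  qed
  ultimately show "?B \<subseteq> ?A" by (auto simp: triples_def)
qed

lemma right_ideal_Elem: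
  assumes "Elem i g l \<in> R"
  shows "right_ideal R (rees_mult G P) (Elem i g l) = insert Zero (triples {i} (carrier G) L)"
    (is "?A = ?B")
proof
  show "?A \<subseteq> ?B"
    using assms unfolding right_ideal_def
    by (auto simp: triples_def rees_carrier_def split: option.splits intro!: m_closed
        dest: entry_closed)
  have "Zero \<in> ?A" unfolding right_ideal_def by (auto intro!: exI[of _ Zero])
  moreover have "Elem i h m \<in> ?A" if "m \<in> L" "h \<in> carrier G" for m h
  proof -
    obtain j p where j: "j \<in> I" "P l j = Some p" using row_nonzero assms by auto
    have p: "p \<in> carrier G" using j entry_closed assms by simp
    have eq: "Elem i h m = Elem i g l \<bullet> Elem j (inv p \<otimes> (inv g \<otimes> h)) m"
      using j p that assms
      by (simp add: m_assoc flip: m_assoc[of p "inv p"] m_assoc[of g "inv g"])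
    have "Elem j (inv p \<otimes> (inv g \<otimes> h)) m \<in> R" using j p that assms by simp
    with eq show ?thesis unfolding right_ideal_def by (intro insertI2 CollectI exI conjI)
  qed
  ultimately show "?B \<subseteq> ?A" by (auto simp: triples_def)
qed

text \<open>Among non-zero elements the left ideal determines exactly \<open>l\<close> and the right
  ideal exactly \<open>i\<close>; the group coordinate leaves no trace in either.\<close>

lemma green_H_Elem:
  assumes "Elem i g l \<in> R"
  shows "green_H R (rees_mult G P) `` {Elem i g l} = triples {i} (carrier G) {l}"
proof -
  have il: "i \<in> I" "g \<in> carrier G" "l \<in> L" using assms by auto
  have "(Elem i g l, x) \<in> green_H R (rees_mult G P) \<longleftrightarrow> x \<in> triples {i} (carrier G) {l}" for x
  proof (cases x)
    case Zero
    have "left_ideal R (rees_mult G P) Zero = {Zero}" by (auto simp: left_ideal_def)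
    moreover have "Elem i g l \<in> left_ideal R (rees_mult G P) (Elem i g l)"
      by (simp add: left_ideal_def)
    ultimately show ?thesis using Zero by (auto simp: green_H_def triples_def)
  next
    case (Elem j h m)
    have "Elem i g l \<in> insert Zero (triples I (carrier G) {m}) \<longleftrightarrow> l = m"
      using il by (simp add: triples_def)
    moreover have "Elem i g l \<in> insert Zero (triples I (carrier G) {l})"
      using il by (simp add: triples_def)
    ultimately have left:
      "insert Zero (triples I (carrier G) {l}) = insert Zero (triples I (carrier G) {m}) \<longleftrightarrow> l = m"
      by metis
    have "Elem i g l \<in> insert Zero (triples {j} (carrier G) L) \<longleftrightarrow> i = j"
      using il by (simp add: triples_def)
    moreover have "Elem i g l \<in> insert Zero (triples {i} (carrier G) L)"
      using il by (simp add: triples_def)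
    ultimately have right:
      "insert Zero (triples {i} (carrier G) L) = insert Zero (triples {j} (carrier G) L) \<longleftrightarrow> i = j"
      by metis
    show ?thesis
      using Elem assms left right by (auto simp: green_H_def left_ideal_Elem right_ideal_Elem triples_def)
  qed
  then show ?thesis by auto
qed

section \<open>Subsemigroups meeting every H-class\<close>

lemma meets_all_H_classes_iff:
  "(\<forall>H \<in> R // green_H R (rees_mult G P). S \<inter> H \<noteq> {}) \<longleftrightarrow>
     Zero \<in> S \<and> (\<forall>i\<in>I. \<forall>l\<in>L. \<exists>h\<in>carrier G. Elem i h l \<in> S)"
proof -
  have "(\<forall>H \<in> R // green_H R (rees_mult G P). S \<inter> H \<noteq> {}) \<longleftrightarrow>
      (\<forall>x\<in>R. S \<inter> green_H R (rees_mult G P) `` {x} \<noteq> {})"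
    unfolding quotient_def by blast
  also have "\<dots> \<longleftrightarrow> S \<inter> green_H R (rees_mult G P) `` {Zero} \<noteq> {} \<and>
      (\<forall>i\<in>I. \<forall>g\<in>carrier G. \<forall>l\<in>L. S \<inter> green_H R (rees_mult G P) `` {Elem i g l} \<noteq> {})"
    unfolding rees_carrier_def triples_def by blast
  also have "\<dots> \<longleftrightarrow> Zero \<in> S \<and> (\<forall>i\<in>I. \<forall>l\<in>L. \<exists>h\<in>carrier G. Elem i h l \<in> S)"
    using one_closed by (auto simp: green_H_Zero green_H_Elem triples_def)
  finally show ?thesis .
qed

text \<open>The map sending w to (i, w p^-1, l) turns multiplication in \<open>G\<close> into
  multiplication in the H-class, so the part of \<open>T\<close> in that class pulls back to a
  non-empty closed subset of a finite group.\<close>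

lemma H_class_subgroup:
  assumes T: "semi T" and i: "i \<in> I" and l: "l \<in> L" and p: "P l i = Some p"
    and ne: "\<exists>h\<in>carrier G. Elem i h l \<in> T"
  shows "subgroup {w \<in> carrier G. Elem i (w \<otimes> inv p) l \<in> T} G" (is "subgroup ?H G")
proof (rule finite_closed_subgroup[OF finite_carrier])
  have pc: "p \<in> carrier G" using entry_closed p i l by blast
  show "?H \<subseteq> carrier G" by blast
  obtain h where "h \<in> carrier G" "Elem i h l \<in> T" using ne by blast
  then have "h \<otimes> p \<in> ?H" using pc by (simp add: m_assoc)
  then show "?H \<noteq> {}" by blast
  fix a b assume "a \<in> ?H" "b \<in> ?H"
  moreover from this have "Elem i (a \<otimes> inv p) l \<bullet> Elem i (b \<otimes> inv p) l \<in> T"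
    using subsemigroup_mult[OF T] by blast
  ultimately show "a \<otimes> b \<in> ?H"
    using pc p by (simp add: m_assoc flip: m_assoc[of "inv p" p])
qed

text \<open>Finiteness enters here: powers of an element of a group \<open>\<H>\<close>-class reach its idempotent.\<close>

lemma E_subset_if_meets:
  assumes T: "semi T" and Z: "Zero \<in> T"
    and meets: "\<And>i l. i \<in> I \<Longrightarrow> l \<in> L \<Longrightarrow> \<exists>h\<in>carrier G. Elem i h l \<in> T"
  shows "E \<subseteq> T"
proof
  fix x assume "x \<in> E"
  then consider "x = Zero"
    | i l p where "i \<in> I" "l \<in> L" "P l i = Some p" "x = Elem i (inv p) l"
    unfolding mem_E_iff by blast
  then show "x \<in> T"
  proof cases
    case 2
    \<comment> \<open>The identity of the subgroup corresponds to the idempotent (i, p^-1,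
      l).\<close>
    have "Elem i (\<one> \<otimes> inv p) l \<in> T"
      using subgroup.one_closed[OF H_class_subgroup[OF T 2(1-3) meets]] 2 by blast
    then show ?thesis using 2 entry_closed by simp
  qed (use Z in simp)
qed

lemma diagonal_subgroup:
  assumes T: "semi T" and k: "k \<in> {1..n}"
    and ne: "\<exists>h\<in>carrier G. Elem (ik k) h (lk k) \<in> T"
  shows "subgroup {w \<in> carrier G. Elem (ik k) w (lk k) \<in> T} G"
proof -
  have "{w \<in> carrier G. Elem (ik k) (w \<otimes> inv \<one>) (lk k) \<in> T}
      = {w \<in> carrier G. Elem (ik k) w (lk k) \<in> T}"
    by auto
  then show ?thesis using H_class_subgroup[OF T ik_in lk_in P_lk_ik ne] k by simp
qed

text \<open>Any g found in the position (\<open>ik 1\<close>, \<open>lk k\<close>) works. An h from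
  (\<open>ik k\<close>, \<open>lk 1\<close>) is corrected to g^-1 by multiplying with (h g)^-1,
  available because the elements of \<open>T\<close> at (\<open>ik k\<close>, \<open>lk k\<close>)
  form a subgroup.\<close>

lemma connecting_elements:
  assumes T: "semi T" and Z: "Zero \<in> T"
    and meets: "\<And>i l. i \<in> I \<Longrightarrow> l \<in> L \<Longrightarrow> \<exists>h\<in>carrier G. Elem i h l \<in> T"
    and k: "k \<in> {1..n}"
  shows "\<exists>g\<in>carrier G. Elem (ik 1) g (lk k) \<in> T \<and> Elem (ik k) (inv g) (lk 1) \<in> T"
proof -
  obtain g where g: "g \<in> carrier G" "Elem (ik 1) g (lk k) \<in> T"
    using meets ik_in lk_in k one_in by blast
  obtain h where h: "h \<in> carrier G" "Elem (ik k) h (lk 1) \<in> T"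
    using meets ik_in lk_in k one_in by blast
  let ?D = "{w \<in> carrier G. Elem (ik k) w (lk k) \<in> T}"
  have D: "subgroup ?D G" using diagonal_subgroup T k meets ik_in lk_in by blast
  have "Elem (ik k) h (lk 1) \<bullet> Elem (ik 1) g (lk k) \<in> T"
    by (rule subsemigroup_mult[OF T h(2) g(2)])
  then have "h \<otimes> g \<in> ?D" using g h one_in P_lk_ik by simp
  then have "inv (h \<otimes> g) \<in> ?D" using subgroup.m_inv_closed[OF D] by blast
  then have "Elem (ik k) (inv (h \<otimes> g)) (lk k) \<bullet> Elem (ik k) h (lk 1) \<in> T"
    using h by (intro subsemigroup_mult[OF T]) auto
  moreover have "inv (h \<otimes> g) \<otimes> h = inv g"
    using g h by (simp add: inv_mult_group m_assoc)
  ultimately have "Elem (ik k) (inv g) (lk 1) \<in> T" using g h k P_lk_ik by simp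
  then show ?thesis using g by blast
qed

text \<open>The product of x_k, (\<open>ik k\<close>, a, \<open>lk k\<close>) and y_k has group
  coordinate g_k a g_k^-1, and its middle factor is a product of idempotents.\<close>

lemma conjugates_into_first_group:
  assumes T: "semi T" and E: "E \<subseteq> T"
    and g: "\<And>k. k \<in> {1..n} \<Longrightarrow> g k \<in> carrier G"
    and x: "\<And>k. k \<in> {1..n} \<Longrightarrow> Elem (ik 1) (g k) (lk k) \<in> T"
    and y: "\<And>k. k \<in> {1..n} \<Longrightarrow> Elem (ik k) (inv (g k)) (lk 1) \<in> T"
  shows "conjugates_into {v \<in> carrier G. Elem (ik 1) v (lk 1) \<in> T} g"
proof -
  have "g k \<otimes> a \<otimes> inv (g k) \<in> {v \<in> carrier G. Elem (ik 1) v (lk 1) \<in> T}"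
    if k: "k \<in> {1..n}" and a: "a \<in> Gk k" for k a
  proof -
    have "Elem (ik k) a (lk k) \<in> T"
      using IG_least[OF T E] block_in_IG[OF ik_in lk_in] k a comp_ik comp_lk by auto
    then have "Elem (ik 1) (g k) (lk k) \<bullet> Elem (ik k) a (lk k) \<bullet> Elem (ik k) (inv (g k)) (lk 1) \<in> T"
      using x y k by (intro subsemigroup_mult[OF T]) auto
    then show ?thesis using k a g Gk_carrier P_lk_ik by simp
  qed
  then show ?thesis by (simp add: conjugates_into_def)
qed

section \<open>Maximal subgroups and maximal subsemigroups\<close>

lemma maximal_subsemigroup_imp_generated:
  assumes max: "maximal_subsemigroup R (rees_mult G P) S"
    and Z: "Zero \<in> S" and meets: "\<And>i l. i \<in> I \<Longrightarrow> l \<in> L \<Longrightarrow> \<exists>h\<in>carrier G. Elem i h l \<in> S"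
  shows "\<exists>V g. maximal_subgroup G V \<and> (\<forall>k\<in>{1..n}. g k \<in> carrier G) \<and> g 1 = \<one> \<and>
    conjugates_into V g \<and> S = generated_subsemigroup R (rees_mult G P) (gens g V)"
proof -
  have S: "semi S" using max by (simp add: maximal_subsemigroup_def)
  have E: "E \<subseteq> S" using E_subset_if_meets S Z meets by blast
  define V where "V = {v \<in> carrier G. Elem (ik 1) v (lk 1) \<in> S}"
  have V: "subgroup V G"
    unfolding V_def using diagonal_subgroup S one_in meets ik_in lk_in by blast
  obtain g0 where g0: "\<And>k. k \<in> {1..n} \<Longrightarrow> g0 k \<in> carrier G \<and>
      Elem (ik 1) (g0 k) (lk k) \<in> S \<and> Elem (ik k) (inv (g0 k)) (lk 1) \<in> S"
    using connecting_elements[OF S Z meets] by metis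
  \<comment> \<open>The chosen value at 1 may be any element of \<open>V\<close>; resetting it to
    the identity is harmless since the identity lies in \<open>V\<close>.\<close>
  define g where "g = g0(1 := \<one>)"
  have "Elem (ik 1) \<one> (lk 1) \<in> S" using subgroup.one_closed[OF V] by (simp add: V_def)
  then have g: "g k \<in> carrier G" "Elem (ik 1) (g k) (lk k) \<in> S" "Elem (ik k) (inv (g k)) (lk 1) \<in> S"
    if "k \<in> {1..n}" for k
    using g0[OF that] by (auto simp: g_def)
  have g1: "g 1 = \<one>" by (simp add: g_def)
  have conj: "conjugates_into V g"
    unfolding V_def using conjugates_into_first_group[OF S E] g by blast
  have S_eq: "S = block V g"
    unfolding V_def using subsemigroup_eq_block[of g S] g g1 S E by auto
  have VG: "V \<subseteq> carrier G" by (auto simp: V_def)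
  have "V \<noteq> carrier G"
    using max block_eq_R_iff[of g, OF _ VG g1] g S_eq by (auto simp: maximal_subsemigroup_def)
  \<comment> \<open>A proper subgroup \<open>H\<close> above \<open>V\<close> yields a proper block
    above \<open>S\<close> with the same \<open>g\<close>, as \<open>conjugates_into\<close> is
    monotone in the subgroup.\<close>
  moreover have "H = V" if H: "subgroup H G" "H \<noteq> carrier G" "V \<subseteq> H" for H
  proof -
    have HG: "H \<subseteq> carrier G" using H(1) by (rule subgroup.subset)
    have "conjugates_into H g" using conj H by (auto simp: conjugates_into_def)
    then have "semi (block H g)" using semi_block[of g] g H by blast
    moreover have "block H g \<noteq> R" using block_eq_R_iff[of g, OF _ HG g1] g H by blast
    moreover have "S \<subseteq> block H g" unfolding S_eq using block_mono[of g] g H by blast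
    ultimately have "block H g = block V g" using max S_eq unfolding maximal_subsemigroup_def by blast
    then show ?thesis using block_inject[of g, OF _ _ HG VG g1] g by blast
  qed
  ultimately have "maximal_subgroup G V" using V by (auto simp: maximal_subgroup_def)
  moreover have "S = generated_subsemigroup R (rees_mult G P) (gens g V)"
    using generated_eq_block[of g V] V conj g1 g S_eq by simp
  ultimately show ?thesis using g g1 conj by blast
qed

text \<open>A proper subsemigroup \<open>T\<close> above the block contains its generators, hence is
  a block for the same \<open>g\<close> over a proper subgroup \<open>W\<close> above
  \<open>V\<close>. Maximality of \<open>V\<close> forces \<open>W\<close> =
  \<open>V\<close>.\<close>

lemma block_maximal_subsemigroup:
  assumes max: "maximal_subgroup G V" and g: "\<And>k. k \<in> {1..n} \<Longrightarrow> g k \<in> carrier G"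
    and g1: "g 1 = \<one>" and conj: "conjugates_into V g"
  shows "maximal_subsemigroup R (rees_mult G P) (block V g)"
    and "i \<in> I \<Longrightarrow> l \<in> L \<Longrightarrow> \<exists>h\<in>carrier G. Elem i h l \<in> block V g"
proof -
  have V: "subgroup V G" using max by (simp add: maximal_subgroup_def)
  have VG: "V \<subseteq> carrier G" using V by (rule subgroup.subset)
  have meets: "\<exists>h\<in>carrier G. Elem i h l \<in> block V g" if "i \<in> I" "l \<in> L" for i l
  proof -
    have gc: "g (comp i) \<in> carrier G" "g (comp l) \<in> carrier G" using that g comp_in by auto
    \<comment> \<open>The witness is the element that is transported to the identity, which lies in
      every subgroup.\<close>
    then have "g (comp i) \<otimes> (inv (g (comp i)) \<otimes> g (comp l)) \<otimes> inv (g (comp l)) = \<one>"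
      by (simp add: m_assoc flip: m_assoc[of "g (comp i)" "inv (g (comp i))"])
    then show ?thesis using that gc subgroup.one_closed[OF V]
      by (intro bexI[of _ "inv (g (comp i)) \<otimes> g (comp l)"]) (simp_all add: Elem_in_block)
  qed
  then show "i \<in> I \<Longrightarrow> l \<in> L \<Longrightarrow> \<exists>h\<in>carrier G. Elem i h l \<in> block V g" .
  have "T = block V g" if T: "semi T" "T \<noteq> R" "block V g \<subseteq> T" for T
  proof -
    define W where "W = {v \<in> carrier G. Elem (ik 1) v (lk 1) \<in> T}"
    have "generated_subsemigroup R (rees_mult G P) (gens g V) = block V g"
      by (rule generated_eq_block[OF _ V conj g1]) (rule g)
    then have "gens g V \<subseteq> T"
      using order_trans[OF generated_subsemigroup_superset order_trans[OF equalityD1 T(3)]]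
      by blast
    have T_eq: "T = block W g"
      unfolding W_def by (rule subsemigroup_eq_block[of g T, OF _ T(1) _ g1])
        (use g \<open>gens g V \<subseteq> T\<close> in auto)
    have "subgroup W G"
      unfolding W_def using diagonal_subgroup[OF T(1) one_in] T(3) meets ik_in lk_in one_in by blast
    moreover have "W \<noteq> carrier G"
      using block_eq_R_iff[of g W] g g1 T(2) T_eq by blast
    moreover have "V \<subseteq> W"
      using \<open>gens g V \<subseteq> T\<close> VG by (auto simp: W_def triples_def)
    ultimately show ?thesis using max T_eq by (auto simp: maximal_subgroup_def)
  qed
  moreover have "semi (block V g)" using semi_block[of g] g V conj by blast
  moreover have "block V g \<noteq> R"
    using block_eq_R_iff[of g V] g g1 VG max by (auto simp: maximal_subgroup_def)
  ultimately show "maximal_subsemigroup R (rees_mult G P) (block V g)"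
    by (auto simp: maximal_subsemigroup_def)
qed

end

theorem proposition2p7:
  fixes G :: "('g, 'm) monoid_scheme"
    and I L :: "'v set"
    and P :: "'v \<Rightarrow> 'v \<Rightarrow> 'g option"
    and R S :: "('v, 'g, 'v) rees set"
    and n :: nat
    and C :: "nat \<Rightarrow> 'v set"
    and ik lk :: "nat \<Rightarrow> 'v"
    and Gk :: "nat \<Rightarrow> 'g set"
  defines "R \<equiv> rees_carrier G I L"
  assumes "rees_zero_matrix G I L P"
    and "finite R"
    and "regular_semigroup R (rees_mult G P)"
    and "normalization G I L P n C ik lk Gk"
    and "subsemigroup R (rees_mult G P) S"
  shows "maximal_subsemigroup R (rees_mult G P) S \<and>
           (\<forall>H \<in> R // green_H R (rees_mult G P). S \<inter> H \<noteq> {})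
         \<longleftrightarrow>
         (\<exists>V g. maximal_subgroup G V \<and>
            (\<forall>k\<in>{1..n}. g k \<in> carrier G) \<and> g 1 = \<one>\<^bsub>G\<^esub> \<and>
            (\<forall>k\<in>{1..n}. Gk k \<subseteq> (inv\<^bsub>G\<^esub> (g k) <#\<^bsub>G\<^esub> V) #>\<^bsub>G\<^esub> g k) \<and>
            S = generated_subsemigroup R (rees_mult G P)
                  (idempotents R (rees_mult G P)
                   \<union> triples {ik 1} V {lk 1}
                   \<union> {Elem (ik 1) (g k) (lk k) |k. k \<in> {2..n}}
                   \<union> {Elem (ik k) (inv\<^bsub>G\<^esub> (g k)) (lk 1) |k. k \<in> {2..n}}))"
    (is "?lhs \<longleftrightarrow> ?rhs")
proof -
  interpret rees_zero_matrix G I L P by fact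
  interpret normalized_rees_zero_matrix G I L P n C ik lk Gk
    by unfold_locales (use assms(3,5) in \<open>simp_all add: R_def\<close>)
  show ?thesis
  proof
    assume ?lhs
    then obtain V g where "maximal_subgroup G V" "\<forall>k\<in>{1..n}. g k \<in> carrier G" "g 1 = \<one>\<^bsub>G\<^esub>"
      "conjugates_into V g" "S = generated_subsemigroup R (rees_mult G P) (gens g V)"
      using maximal_subsemigroup_imp_generated[of S] unfolding R_def meets_all_H_classes_iff by blast
    moreover from this have "\<forall>k\<in>{1..n}. Gk k \<subseteq> (inv\<^bsub>G\<^esub> (g k) <#\<^bsub>G\<^esub> V) #>\<^bsub>G\<^esub> g k"
      using conjugates_into_iff[of g V] by (simp add: maximal_subgroup_def)
    ultimately show ?rhs unfolding R_def by blast
  next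
    assume ?rhs
    then obtain V g where V: "maximal_subgroup G V" and g: "\<forall>k\<in>{1..n}. g k \<in> carrier G"
      and g1: "g 1 = \<one>\<^bsub>G\<^esub>"
      and sub: "\<forall>k\<in>{1..n}. Gk k \<subseteq> (inv\<^bsub>G\<^esub> (g k) <#\<^bsub>G\<^esub> V) #>\<^bsub>G\<^esub> g k"
      and S: "S = generated_subsemigroup R (rees_mult G P) (gens g V)"
      unfolding R_def by blast
    have sg: "subgroup V G" using V by (simp add: maximal_subgroup_def)
    have conj: "conjugates_into V g" using conjugates_into_iff[of g V] g sg sub by blast
    \<comment> \<open>In block form, both maximality and the intersection with every H-class can be
      read off from \<open>V\<close>.\<close>
    have "S = block V g" using generated_eq_block[of g V] g g1 sg conj S by (simp add: R_def)
    then show ?lhs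
      using block_maximal_subsemigroup[OF V _ g1 conj] g Zero_in_block
      unfolding R_def meets_all_H_classes_iff by blast
  qed
qed

end
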